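(* Let $\Omega\subset\mathbb{R}^2$ be a domain with boundary $\partial\Omega=\partial\Omega_+\cup\partial\Omega_-$, and let $\mu:\bar\Omega\to\bar\Omega$ be a continuous map with $\mu^2=\mathrm{id}$ and $\mu(\partial\Omega_+)=\partial\Omega_-$. Let $G=(V,E)$ be a finite graph with $V=I\cup B$ (disjoint union of interior and boundary vertices), embedded in $\bar\Omega$ by points $x_i$ in the interior of $\Omega$ for $i\in I$ and $x_b\in\partial\Omega$ for $b\in B$. Let $f=(f_b)_{b\in B}$ be the boundary condition with $f_b=1$ if $x_b\in\partial\Omega_+$ and $f_b=-1$ if $x_b\in\partial\Omega_-$. Let $\beta>0$ and let $p_{\mathrm{V}}$ be the Ising distribution on $\{-1,+1\}^I$ with boundary condition $f$, $$p_{\mathrm{V}}(s)\propto \exp\Big(\beta\sum_{ij\in E}s_is_j+\beta\sum_{ib\in E}s_if_b\Big).$$ Let $m:I\to I$ be an involution, $m^2=\mathrm{id}$, and let $\eta\in(0,1)$. Let $P_{\mathrm{MDF}}$ be the transition matrix of the Metropolized double flip move associated with $m$, let $P_{\mathrm{SW}}$ be the transition matrix of the Swendsen-Wang move with boundary condition $f$, and let $$P=\eta P_{\mathrm{MDF}}+(1-\eta)P_{\mathrm{SW}}$$ be the transition matrix of the Swendsen-Wang algorithm with Metropolized double flip. Then this algorithm satisfies detailed balance with respect to $p_{\mathrm{V}}$: for all $s,t\in\{-1,+1\}^I$, $$p_{\mathrm{V}}(s)\,P(s,t)=p_{\mathrm{V}}(t)\,P(t,s).$$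
   Context: The graph is simple and undirected. Every edge is either an interior edge $ij$ with $i,j\in I$, or an edge $ib$ joining an interior vertex $i\in I$ to a boundary vertex $b\in B$; the letters $i,j$ always denote vertices of $I$ and $b$ a vertex of $B$. Thus $\sum_{ij\in E}$ is the sum over interior edges (each unordered edge counted once) and $\sum_{ib\in E}$ the sum over interior-boundary edges. A spin configuration is $s=(s_i)_{i\in I}\in\{-1,+1\}^I$, and $\propto$ means equality up to the normalization constant making $p_{\mathrm{V}}$ a probability distribution on $\{-1,+1\}^I$. Metropolized double flip move, from the current configuration $s$: (1) define the proposal $t'$ by $t'_i=-s_{m(i)}$ for all $i\in I$; (2) let $c=\min(1,p_{\mathrm{V}}(t')/p_{\mathrm{V}}(s))$; (3) sample $u\in[0,1]$ uniformly; if $u\le c$ the new configuration is $t'$, otherwise the new configuration is $s$. $P_{\mathrm{MDF}}(s,t)$ is the probability that the new configuration is $t$; that is, $P_{\mathrm{MDF}}(s,t)=c\,\mathbf{1}[t=t']+(1-c)\,\mathbf{1}[t=s]$, where $t'$ and $c$ are determined by $s$ through $t'_i=-s_{m(i)}$ for all $i\in I$ and $c=\min(1,p_{\mathrm{V}}(t')/p_{\mathrm{V}}(s))$. Swendsen-Wang move (with boundary condition $f$), from $s$ to a new configuration $t$: (1) Generate a random edge configuration $w\in\{0,1\}^E$ with independent entries: for an interior edge $ij$, $w_{ij}=0$ if $s_i\ne s_j$, and if $s_i=s_j$ then $w_{ij}=1$ with probability $1-e^{-2\beta}$ and $w_{ij}=0$ with probability $e^{-2\beta}$; for an edge $ib$,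 the same rule with $s_j$ replaced by $f_b$. (2) Consider the connected components of the graph with vertex set $V$ and edge set $\{e\in E: w_e=1\}$. For each component containing a boundary vertex $b$, set $t_i=f_b$ for all interior vertices $i$ of the component (this is well defined, since for $w$ produced by step (1) all boundary vertices in one component have the same value of $f$). For each component containing only interior vertices, set all its spins $t_i$ to $+1$ or all to $-1$, with probability $1/2$ each, independently over components. Then $P_{\mathrm{SW}}(s,t)$ is the probability that this procedure, started from $s$, outputs $t$. The combined algorithm performs, at each iteration, the Metropolized double flip move with probability $\eta$ and the Swendsen-Wang move with probability $1-\eta$. *)

theory Defs
  imports "HOL-Probability.Probability"
begin

text \<open>
  A graph is given by its disjoint sets \<open>I\<close> and \<open>B\<close> of interior and boundary vertices and its set
  \<open>E\<close> of two-element edges. There are no edges inside \<open>B\<close>.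
\<close>

definition ising_graph :: "'v set \<Rightarrow> 'v set \<Rightarrow> 'v set set \<Rightarrow> bool" where
  "ising_graph I B E \<longleftrightarrow>
     finite I \<and> finite B \<and> I \<inter> B = {} \<and>
     E \<subseteq> {{i, j} |i j. i \<in> I \<and> j \<in> I \<and> i \<noteq> j} \<union> {{i, b} |i b. i \<in> I \<and> b \<in> B}"

definition configs :: "'v set \<Rightarrow> ('v \<Rightarrow> real) set" where
  "configs I = (\<Pi>\<^sub>E i\<in>I. {-1, 1})"

text \<open>
  For an interior edge \<open>e = {i, j}\<close> the product over \<open>e\<close> is \<open>s i * s j\<close>; indexing by \<open>e\<close> counts each
  unordered edge once.
\<close>

definition ising_weight ::
  "'v set \<Rightarrow> 'v set \<Rightarrow> 'v set set \<Rightarrow> ('v \<Rightarrow> real) \<Rightarrow> real \<Rightarrow> ('v \<Rightarrow> real) \<Rightarrow> real" where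
  "ising_weight I B E f \<beta> s =
     exp (\<beta> * (\<Sum>e\<in>{e \<in> E. e \<subseteq> I}. \<Prod>v\<in>e. s v)
        + \<beta> * (\<Sum>(i, b)\<in>{(i, b) \<in> I \<times> B. {i, b} \<in> E}. s i * f b))"

definition p_V ::
  "'v set \<Rightarrow> 'v set \<Rightarrow> 'v set set \<Rightarrow> ('v \<Rightarrow> real) \<Rightarrow> real \<Rightarrow> ('v \<Rightarrow> real) \<Rightarrow> real" where
  "p_V I B E f \<beta> s =
     ising_weight I B E f \<beta> s / (\<Sum>r\<in>configs I. ising_weight I B E f \<beta> r)"

definition flip_proposal :: "'v set \<Rightarrow> ('v \<Rightarrow> 'v) \<Rightarrow> ('v \<Rightarrow> real) \<Rightarrow> ('v \<Rightarrow> real)" where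
  "flip_proposal I m s = (\<lambda>i\<in>I. - s (m i))"

definition P_MDF ::
  "'v set \<Rightarrow> 'v set \<Rightarrow> 'v set set \<Rightarrow> ('v \<Rightarrow> real) \<Rightarrow> real \<Rightarrow> ('v \<Rightarrow> 'v)
     \<Rightarrow> ('v \<Rightarrow> real) \<Rightarrow> ('v \<Rightarrow> real) \<Rightarrow> real" where
  "P_MDF I B E f \<beta> m s t =
     (let t' = flip_proposal I m s;
          c = min 1 (p_V I B E f \<beta> t' / p_V I B E f \<beta> s)
      in c * of_bool (t = t') + (1 - c) * of_bool (t = s))"

definition spin_with_bc :: "'v set \<Rightarrow> ('v \<Rightarrow> real) \<Rightarrow> ('v \<Rightarrow> real) \<Rightarrow> 'v \<Rightarrow> real" where
  "spin_with_bc I f s v = (if v \<in> I then s v else f v)"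

text \<open>
  An edge configuration is a function into \<open>bool\<close>, with \<open>True\<close> for the value 1; its value outside \<open>E\<close>
  is \<open>False\<close>.
\<close>

definition edge_pmf ::
  "'v set \<Rightarrow> 'v set set \<Rightarrow> ('v \<Rightarrow> real) \<Rightarrow> real \<Rightarrow> ('v \<Rightarrow> real) \<Rightarrow> ('v set \<Rightarrow> bool) pmf" where
  "edge_pmf I E f \<beta> s =
     Pi_pmf E False
       (\<lambda>e. if \<forall>u\<in>e. \<forall>v\<in>e. spin_with_bc I f s u = spin_with_bc I f s v
            then bernoulli_pmf (1 - exp (- 2 * \<beta>))
            else return_pmf False)"

definition component_of :: "'v set set \<Rightarrow> ('v set \<Rightarrow> bool) \<Rightarrow> 'v \<Rightarrow> 'v set" where
  "component_of E w v = {(x, y). {x, y} \<in> E \<and> w {x, y}}\<^sup>* `` {v}"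

definition components_of :: "'v set \<Rightarrow> 'v set \<Rightarrow> 'v set set \<Rightarrow> ('v set \<Rightarrow> bool) \<Rightarrow> 'v set set" where
  "components_of I B E w = component_of E w ` (I \<union> B)"

text \<open>
  Given an edge configuration \<open>w\<close>, every component without boundary vertices draws an independent
  fair sign. In the other components the choice of the boundary vertex is immaterial for every \<open>w\<close>
  in the support of the edge distribution, since \<open>f\<close> is then constant on the boundary vertices of
  each component.
\<close>

definition recolor_pmf ::
  "'v set \<Rightarrow> 'v set \<Rightarrow> 'v set set \<Rightarrow> ('v \<Rightarrow> real) \<Rightarrow> ('v set \<Rightarrow> bool) \<Rightarrow> ('v \<Rightarrow> real) pmf" where
  "recolor_pmf I B E f w =
     map_pmf
       (\<lambda>g. \<lambda>i\<in>I. let C = component_of E w i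
                  in if C \<inter> B = {} then g C else f (SOME b. b \<in> C \<inter> B))
       (Pi_pmf {C \<in> components_of I B E w. C \<inter> B = {}} 0 (\<lambda>_. pmf_of_set {-1, 1}))"

definition SW_pmf ::
  "'v set \<Rightarrow> 'v set \<Rightarrow> 'v set set \<Rightarrow> ('v \<Rightarrow> real) \<Rightarrow> real \<Rightarrow> ('v \<Rightarrow> real) \<Rightarrow> ('v \<Rightarrow> real) pmf" where
  "SW_pmf I B E f \<beta> s = bind_pmf (edge_pmf I E f \<beta> s) (recolor_pmf I B E f)"

definition P_SW ::
  "'v set \<Rightarrow> 'v set \<Rightarrow> 'v set set \<Rightarrow> ('v \<Rightarrow> real) \<Rightarrow> real
     \<Rightarrow> ('v \<Rightarrow> real) \<Rightarrow> ('v \<Rightarrow> real) \<Rightarrow> real" where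
  "P_SW I B E f \<beta> s t = pmf (SW_pmf I B E f \<beta> s) t"

definition P_SWMDF ::
  "'v set \<Rightarrow> 'v set \<Rightarrow> 'v set set \<Rightarrow> ('v \<Rightarrow> real) \<Rightarrow> real \<Rightarrow> ('v \<Rightarrow> 'v) \<Rightarrow> real
     \<Rightarrow> ('v \<Rightarrow> real) \<Rightarrow> ('v \<Rightarrow> real) \<Rightarrow> real" where
  "P_SWMDF I B E f \<beta> m \<eta> s t = \<eta> * P_MDF I B E f \<beta> m s t + (1 - \<eta>) * P_SW I B E f \<beta> s t"

end

theory Submission imports Defs begin

text \<open>
  Detailed balance is checked for the two moves separately. The double flip proposal is an
  involution, so for it this is the usual Metropolis computation. For Swendsen-Wang it follows from
  the Edwards-Sokal coupling: the weight of \<open>s\<close> times the probability of drawing the edge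
  configuration \<open>w\<close> from \<open>s\<close> is a weight of \<open>w\<close> alone if \<open>s\<close> is constant along the open edges of
  \<open>w\<close>, and 0 otherwise, while recoloring picks uniformly one of the configurations that are constant
  along the open edges of \<open>w\<close>. Hence the joint weight of \<open>(s, w, t)\<close> is symmetric in \<open>s\<close> and \<open>t\<close>.
\<close>

section \<open>Spins along open edges and on open components\<close>

definition monochromatic :: "'v set \<Rightarrow> ('v \<Rightarrow> real) \<Rightarrow> ('v \<Rightarrow> real) \<Rightarrow> 'v set \<Rightarrow> bool" where
  "monochromatic I f s e \<longleftrightarrow> (\<forall>u\<in>e. \<forall>v\<in>e. spin_with_bc I f s u = spin_with_bc I f s v)"

definition compatible ::
  "'v set \<Rightarrow> 'v set set \<Rightarrow> ('v \<Rightarrow> real) \<Rightarrow> ('v \<Rightarrow> real) \<Rightarrow> ('v set \<Rightarrow> bool) \<Rightarrow> bool" where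
  "compatible I E f s w \<longleftrightarrow> (\<forall>e\<in>E. w e \<longrightarrow> monochromatic I f s e)"

lemma monochromatic_doubleton:
  "monochromatic I f s {u, v} \<longleftrightarrow> spin_with_bc I f s u = spin_with_bc I f s v"
  unfolding monochromatic_def by (metis insert_iff singletonD)

lemma ising_weight_pos: "ising_weight I B E f \<beta> s > 0"
  by (simp add: ising_weight_def)

lemma configs_D: "s \<in> configs I \<Longrightarrow> i \<in> I \<Longrightarrow> s i = - 1 \<or> s i = 1"
  by (auto simp: configs_def PiE_def Pi_def)

lemma configs_outside: "s \<in> configs I \<Longrightarrow> i \<notin> I \<Longrightarrow> s i = undefined"
  unfolding configs_def by (rule PiE_arb)

lemma component_of_refl: "v \<in> component_of E w v"
  by (simp add: component_of_def)

text \<open>The open-edge relation is symmetric because \<open>{x, y} = {y, x}\<close>, so its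
  reflexive transitive closure is an equivalence relation and components are its classes.\<close>

lemma component_of_eq:
  assumes "u \<in> component_of E w v"
  shows "component_of E w u = component_of E w v"
proof -
  let ?R = "{(x, y). {x, y} \<in> E \<and> w {x, y}}"
  have "sym (?R\<^sup>*)"
    by (rule sym_rtrancl) (auto simp: sym_def insert_commute)
  moreover have "(v, u) \<in> ?R\<^sup>*"
    using assms by (simp add: component_of_def)
  ultimately show ?thesis
    unfolding component_of_def by (auto dest: symD intro: rtrancl_trans)
qed

lemma component_of_edge: "{u, v} \<in> E \<Longrightarrow> w {u, v} \<Longrightarrow> v \<in> component_of E w u"
  by (auto simp: component_of_def)

lemma compatible_component_of:
  assumes "compatible I E f s w" and "u \<in> component_of E w v"
  shows "spin_with_bc I f s u = spin_with_bc I f s v"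
proof -
  have "(v, u) \<in> {(x, y). {x, y} \<in> E \<and> w {x, y}}\<^sup>*"
    using assms(2) by (simp add: component_of_def)
  then show ?thesis
  proof induction
    case (step y z)
    then have "monochromatic I f s {y, z}"
      using assms(1) by (auto simp: compatible_def)
    then show ?case
      using step.IH by (simp add: monochromatic_doubleton)
  qed simp
qed

section \<open>Edge factorization of the Ising weight and the joint weight with edges\<close>

locale ising_model =
  fixes I B :: "'v set" and E :: "'v set set" and f :: "'v \<Rightarrow> real"
  assumes graph: "ising_graph I B E"
    and bc: "b \<in> B \<Longrightarrow> f b = - 1 \<or> f b = 1"
begin

lemma finite_I: "finite I" and finite_B: "finite B" and disjoint: "I \<inter> B = {}"
  using graph by (auto simp: ising_graph_def)

lemma finite_configs: "finite (configs I)"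
  unfolding configs_def using finite_I by (intro finite_PiE) auto

lemma finite_E: "finite E"
proof (rule finite_subset)
  show "E \<subseteq> Pow (I \<union> B)"
    using graph by (auto simp: ising_graph_def)
qed (use finite_I finite_B in simp)

lemma edge_cases:
  assumes "e \<in> E"
  obtains i j where "e = {i, j}" "i \<in> I" "j \<in> I" "i \<noteq> j"
    | i b where "e = {i, b}" "i \<in> I" "b \<in> B"
  using assms graph unfolding ising_graph_def by blast

text \<open>Spins and boundary values are signs, so the product over an edge is 1 if the edge is
  monochromatic and -1 otherwise. Interior and boundary edges then contribute by one
  formula.\<close>

lemma ising_weight_eq_prod:
  assumes s: "s \<in> configs I"
  shows "ising_weight I B E f \<beta> s =
           (\<Prod>e\<in>E. exp (if monochromatic I f s e then \<beta> else - \<beta>))"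
proof -
  let ?h = "\<lambda>e. if monochromatic I f s e then 1 else - 1 :: real"
  let ?J = "{(i, b) \<in> I \<times> B. {i, b} \<in> E}"
  let ?EI = "{e \<in> E. e \<subseteq> I}" and ?EB = "{e \<in> E. \<not> e \<subseteq> I}"
  have interior: "(\<Sum>e\<in>?EI. \<Prod>v\<in>e. s v) = (\<Sum>e\<in>?EI. ?h e)"
  proof (rule sum.cong)
    fix e assume "e \<in> ?EI"
    then have "e \<in> E" and "e \<subseteq> I" by auto
    from \<open>e \<in> E\<close> show "(\<Prod>v\<in>e. s v) = ?h e"
    proof (cases rule: edge_cases)
      case (1 i j)
      then show ?thesis
        using configs_D[OF s, of i] configs_D[OF s, of j]
        by (auto simp: monochromatic_doubleton spin_with_bc_def)
    next
      case (2 i b)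
      then show ?thesis
        using \<open>e \<subseteq> I\<close> disjoint by auto
    qed
  qed simp
  have "(\<Sum>(i, b)\<in>?J. s i * f b) = (\<Sum>e\<in>?EB. ?h e)"
  \<comment> \<open>Pairs \<open>(i, b)\<close> are traded for edges \<open>{i, b}\<close>.
    Disjointness of \<open>I\<close> and \<open>B\<close> makes this injective and makes its image
    exactly the edges not contained in \<open>I\<close>.\<close>
  proof (rule sum.reindex_bij_betw[where h = "\<lambda>(i, b). {i, b}", THEN trans[rotated]])
    show "bij_betw (\<lambda>(i, b). {i, b}) ?J ?EB"
      unfolding bij_betw_def
    proof
      show "inj_on (\<lambda>(i, b). {i, b}) ?J"
        using disjoint by (auto simp: inj_on_def doubleton_eq_iff)
      show "(\<lambda>(i, b). {i, b}) ` ?J = ?EB"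
      proof
        show "(\<lambda>(i, b). {i, b}) ` ?J \<subseteq> ?EB"
          using disjoint by auto
        show "?EB \<subseteq> (\<lambda>(i, b). {i, b}) ` ?J"
        proof
          fix e assume "e \<in> ?EB"
          then have "e \<in> E" "\<not> e \<subseteq> I" by auto
          then show "e \<in> (\<lambda>(i, b). {i, b}) ` ?J"
          proof (cases rule: edge_cases)
            case (2 i b)
            with \<open>e \<in> E\<close> show ?thesis
              by (intro image_eqI[of _ _ "(i, b)"]) auto
          qed (use \<open>\<not> e \<subseteq> I\<close> in auto)
        qed
      qed
    qed
    show "(\<Sum>(i, b)\<in>?J. s i * f b) = (\<Sum>p\<in>?J. ?h (case p of (i, b) \<Rightarrow> {i, b}))"
    proof (rule sum.cong)
      fix p assume "p \<in> ?J"
      then obtain i b where p: "p = (i, b)" "i \<in> I" "b \<in> B" by auto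
      then have "b \<notin> I" using disjoint by auto
      then show "(case p of (i, b) \<Rightarrow> s i * f b) = ?h (case p of (i, b) \<Rightarrow> {i, b})"
        using p configs_D[OF s, of i] bc[of b]
        by (auto simp: monochromatic_doubleton spin_with_bc_def)
    qed simp
  qed
  moreover have "(\<Sum>e\<in>?EI. ?h e) + (\<Sum>e\<in>?EB. ?h e) = (\<Sum>e\<in>E. ?h e)"
    using finite_E by (subst sum.union_disjoint[symmetric]) (auto intro: sum.cong)
  ultimately have "ising_weight I B E f \<beta> s = exp (\<beta> * (\<Sum>e\<in>E. ?h e))"
    using interior by (simp add: ising_weight_def distrib_left[symmetric])
  also have "\<dots> = (\<Prod>e\<in>E. exp (\<beta> * ?h e))"
    using finite_E by (simp add: sum_distrib_left exp_sum)
  also have "\<dots> = (\<Prod>e\<in>E. exp (if monochromatic I f s e then \<beta> else - \<beta>))"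
    by (intro prod.cong) auto
  finally show ?thesis .
qed

text \<open>Both factors split over edges. A monochromatic edge contributes
  \<open>exp \<beta> * (1 - exp (- 2 * \<beta>))\<close> when open and
  \<open>exp \<beta> * exp (- 2 * \<beta>)\<close> when closed; any other edge contributes 0 when
  open and \<open>exp (- \<beta>)\<close> when closed. Apart from excluding the 0, these values do
  not depend on \<open>s\<close>.\<close>

lemma edwards_sokal:
  assumes s: "s \<in> configs I" and \<beta>: "\<beta> > 0" and w: "w \<in> PiE_dflt E False (\<lambda>_. UNIV)"
  shows "ising_weight I B E f \<beta> s * pmf (edge_pmf I E f \<beta> s) w =
           of_bool (compatible I E f s w) *
             (\<Prod>e\<in>E. if w e then exp \<beta> - exp (- \<beta>) else exp (- \<beta>))"
proof -
  let ?M = "\<lambda>e. if monochromatic I f s e then bernoulli_pmf (1 - exp (- 2 * \<beta>))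
                 else return_pmf False"
  have "pmf (edge_pmf I E f \<beta> s) w = (\<Prod>e\<in>E. pmf (?M e) (w e))"
    using w finite_E unfolding edge_pmf_def monochromatic_def[symmetric]
    by (intro pmf_Pi') (auto simp: PiE_dflt_def)
  then have "ising_weight I B E f \<beta> s * pmf (edge_pmf I E f \<beta> s) w =
      (\<Prod>e\<in>E. exp (if monochromatic I f s e then \<beta> else - \<beta>) * pmf (?M e) (w e))"
    using s by (simp add: ising_weight_eq_prod prod.distrib)
  also have "\<dots> = (\<Prod>e\<in>E. of_bool (w e \<longrightarrow> monochromatic I f s e) *
                     (if w e then exp \<beta> - exp (- \<beta>) else exp (- \<beta>)))"
  proof (rule prod.cong)
    fix e assume "e \<in> E"
    have "exp \<beta> * exp (- 2 * \<beta>) = exp (- \<beta>)"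
      by (simp flip: exp_add)
    then show "exp (if monochromatic I f s e then \<beta> else - \<beta>) * pmf (?M e) (w e) =
        of_bool (w e \<longrightarrow> monochromatic I f s e) *
          (if w e then exp \<beta> - exp (- \<beta>) else exp (- \<beta>))"
      using \<beta> by (cases "w e") (auto simp: right_diff_distrib)
  qed simp
  also have "\<dots> = of_bool (compatible I E f s w) *
      (\<Prod>e\<in>E. if w e then exp \<beta> - exp (- \<beta>) else exp (- \<beta>))"
    using finite_E by (auto simp: prod.distrib compatible_def intro!: prod.neutral)
  finally show ?thesis .
qed

section \<open>The recoloring step as a uniform choice\<close>

text \<open>The map \<open>h\<close> from sign assignments on boundary-free components to
  configurations is injective, its image within \<open>configs I\<close> is the set of
  configurations compatible with \<open>w\<close>, and each assignment has probability
  \<open>(1 / 2) ^ card A\<close>. Compatibility of \<open>s\<close> guarantees that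
  \<open>f\<close> is constant on the boundary vertices of a component.\<close>

lemma pmf_recolor:
  assumes s: "compatible I E f s w" and t: "t \<in> configs I"
  shows "pmf (recolor_pmf I B E f w) t =
    of_bool (compatible I E f t w) * (1 / 2) ^ card {C \<in> components_of I B E w. C \<inter> B = {}}"
proof -
  define A where "A = {C \<in> components_of I B E w. C \<inter> B = {}}"
  define h where "h = (\<lambda>g. \<lambda>i\<in>I. let C = component_of E w i
                  in if C \<inter> B = {} then g C else f (SOME b. b \<in> C \<inter> B))"
  define D where "D = PiE_dflt A 0 (\<lambda>_. {- 1, 1 :: real})"
  let ?M = "Pi_pmf A 0 (\<lambda>_. pmf_of_set {- 1, 1 :: real})"
  have fin: "finite A"
    using finite_I finite_B by (simp add: A_def components_of_def)
  have recolor: "recolor_pmf I B E f w = map_pmf h ?M"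
    by (simp add: recolor_pmf_def h_def A_def)
  have set_M: "set_pmf ?M = D"
    using fin by (simp add: set_Pi_pmf D_def)
  \<comment> \<open>A component contains its base vertex, so the base vertex of a boundary-free
    component is interior.\<close>
  have A_I: "\<exists>i\<in>I. C = component_of E w i" if "C \<in> A" for C
    using that component_of_refl[of _ E w] by (fastforce simp: A_def components_of_def)
  have A_memI: "component_of E w i \<in> A" if "i \<in> I" "component_of E w i \<inter> B = {}" for i
    using that by (auto simp: A_def components_of_def)
  \<comment> \<open>The sign \<open>g C\<close> can be read off from \<open>h g\<close> at an
    interior vertex of \<open>C\<close>; outside \<open>A\<close> both assignments have the default
    value 0.\<close>
  have inj: "inj_on h D"
  proof (rule inj_onI, rule ext)
    fix g g' C assume g: "g \<in> D" "g' \<in> D" "h g = h g'"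
    show "g C = g' C"
    proof (cases "C \<in> A")
      case True
      then obtain i where "i \<in> I" "C = component_of E w i" "C \<inter> B = {}"
        using A_I by (auto simp: A_def)
      then show ?thesis
        using fun_cong[OF g(3), of i] by (simp add: h_def)
    qed (use g in \<open>simp add: D_def PiE_dflt_def\<close>)
  qed
  have image_iff: "t \<in> h ` D \<longleftrightarrow> compatible I E f t w"
  proof
    assume "t \<in> h ` D"
    then obtain g where t_eq: "t = h g" by auto
    \<comment> \<open>Every edge has an interior endpoint, which is taken as \<open>u\<close>; only
      \<open>v\<close> may lie in \<open>B\<close>.\<close>
    have edge: "t u = spin_with_bc I f t v"
      if uv: "{u, v} \<in> E" "w {u, v}" "u \<in> I" and v: "v \<in> I \<union> B" for u v
    proof (cases "v \<in> I")
      case True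
      then show ?thesis
        using component_of_eq[OF component_of_edge[of u v E w, OF uv(1,2)]] uv(3)
        by (simp add: t_eq h_def spin_with_bc_def)
    next
      case False
      define b where "b = (SOME b. b \<in> component_of E w u \<inter> B)"
      have v': "v \<in> component_of E w u \<inter> B"
        using False v component_of_edge uv by auto
      then have b: "b \<in> component_of E w u \<inter> B"
        unfolding b_def by (rule someI)
      \<comment> \<open>The chosen \<open>b\<close> and the endpoint \<open>v\<close> lie in the
        same component, on which the compatible \<open>s\<close> is constant; hence
        \<open>f b = f v\<close> whatever \<open>SOME\<close> picks.\<close>
      then have "spin_with_bc I f s b = spin_with_bc I f s v"
        using v' compatible_component_of[OF s] by (metis IntD1)
      then have "f b = f v"
        using b v' disjoint by (auto simp: spin_with_bc_def split: if_splits)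
      moreover have "component_of E w u \<inter> B \<noteq> {}"
        using v' by blast
      ultimately show ?thesis
        using False uv(3) by (simp add: t_eq h_def spin_with_bc_def b_def)
    qed
    show "compatible I E f t w"
      unfolding compatible_def
    proof (intro ballI impI)
      fix e assume e: "e \<in> E" "w e"
      from e(1) show "monochromatic I f t e"
      proof (cases rule: edge_cases)
        case (1 i j)
        then show ?thesis
          using edge[of i j] e by (auto simp: monochromatic_doubleton spin_with_bc_def)
      next
        case (2 i b)
        then show ?thesis
          using edge[of i b] e by (auto simp: monochromatic_doubleton spin_with_bc_def)
      qed
    qed
  next
    assume comp: "compatible I E f t w"
    \<comment> \<open>The preimage of \<open>t\<close> assigns to each component the spin of
      \<open>t\<close> at one of its interior vertices; the value 0 off \<open>A\<close> is the
      default that \<open>D\<close> demands.\<close>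
    define g where "g = (\<lambda>C. if C \<in> A then t (SOME i. i \<in> C \<inter> I) else 0)"
    have some: "(SOME i. i \<in> C \<inter> I) \<in> C \<inter> I" if C: "C \<in> A" for C
    proof (rule someI_ex)
      show "\<exists>i. i \<in> C \<inter> I"
        using A_I[OF C] component_of_refl by fastforce
    qed
    have "g \<in> D"
      using some configs_D[OF t] by (auto simp: D_def PiE_dflt_def g_def)
    moreover have "t = h g"
    proof
      fix i
      show "t i = h g i"
      proof (cases "i \<in> I")
        case False
        then show ?thesis
          using configs_outside[OF t] by (simp add: h_def)
      next
        case i: True
        define C where "C = component_of E w i"
        have const: "spin_with_bc I f t u = t i" if "u \<in> C" for u
          using compatible_component_of[OF comp] that i by (simp add: C_def spin_with_bc_def)
        show ?thesis
        proof (cases "C \<inter> B = {}")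
          case True
          then have "C \<in> A" using A_memI i by (simp add: C_def)
          then have "t i = g C"
            using const[of "SOME i. i \<in> C \<inter> I"] some[of C] by (simp add: g_def spin_with_bc_def)
          then show ?thesis
            using i True by (simp add: h_def C_def)
        next
          case False
          define b where "b = (SOME b. b \<in> C \<inter> B)"
          have "b \<in> C \<inter> B"
            unfolding b_def by (rule someI_ex) (use False in blast)
          then have "b \<in> C" and "b \<notin> I"
            using disjoint by auto
          then have "t i = f b"
            using const[of b] by (simp add: spin_with_bc_def)
          then show ?thesis
            using i False by (simp add: h_def C_def b_def)
        qed
      qed
    qed
    ultimately show "t \<in> h ` D" by blast
  qed
  show ?thesis
  proof (cases "compatible I E f t w")
    case True
    then obtain g where g: "g \<in> D" "t = h g"
      using image_iff by auto
    have "pmf (map_pmf h ?M) (h g) = pmf ?M g"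
      using inj g by (intro pmf_map_inj) (simp_all add: set_M)
    also have "\<dots> = (\<Prod>C\<in>A. pmf (pmf_of_set {- 1, 1 :: real}) (g C))"
      using g fin by (intro pmf_Pi') (auto simp: D_def PiE_dflt_def)
    also have "\<dots> = (\<Prod>C\<in>A. 1 / 2)"
      using g by (intro prod.cong) (auto simp: D_def PiE_dflt_def)
    finally show ?thesis
      using True g recolor by (simp add: A_def)
  next
    case False
    then have "t \<notin> set_pmf (recolor_pmf I B E f w)"
      using image_iff by (simp add: recolor set_M)
    then show ?thesis
      using False by (simp add: set_pmf_eq)
  qed
qed

text \<open>Summing the joint weight of \<open>(s, w, t)\<close> over \<open>w\<close> gives an
  expression in which \<open>s\<close> and \<open>t\<close> enter only through the product of their
  compatibility indicators.\<close>

lemma ising_weight_P_SW: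
  assumes s: "s \<in> configs I" and t: "t \<in> configs I" and \<beta>: "\<beta> > 0"
  shows "ising_weight I B E f \<beta> s * P_SW I B E f \<beta> s t =
    (\<Sum>w\<in>PiE_dflt E False (\<lambda>_. UNIV).
       of_bool (compatible I E f s w) * of_bool (compatible I E f t w) *
       (\<Prod>e\<in>E. if w e then exp \<beta> - exp (- \<beta>) else exp (- \<beta>)) *
       (1 / 2) ^ card {C \<in> components_of I B E w. C \<inter> B = {}})"
proof -
  let ?W = "PiE_dflt E False (\<lambda>_. UNIV) :: ('v set \<Rightarrow> bool) set"
  have "finite ?W"
    using finite_E by (intro finite_PiE_dflt) auto
  \<comment> \<open>With a finite set containing the support, the integral in
    \<open>pmf_bind\<close> becomes a finite sum, over an index set independent of
    \<open>s\<close>.\<close>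
  moreover have "set_pmf (edge_pmf I E f \<beta> s) \<subseteq> ?W"
    using set_Pi_pmf_subset[OF finite_E] by (fastforce simp: edge_pmf_def PiE_dflt_def)
  ultimately have "P_SW I B E f \<beta> s t =
      (\<Sum>w\<in>?W. pmf (recolor_pmf I B E f w) t * pmf (edge_pmf I E f \<beta> s) w)"
    unfolding P_SW_def SW_pmf_def pmf_bind by (intro integral_measure_pmf_real) auto
  then have "ising_weight I B E f \<beta> s * P_SW I B E f \<beta> s t =
      (\<Sum>w\<in>?W. (ising_weight I B E f \<beta> s * pmf (edge_pmf I E f \<beta> s) w) *
                 pmf (recolor_pmf I B E f w) t)"
    by (simp add: sum_distrib_left mult_ac)
  also have "\<dots> = (\<Sum>w\<in>?W.
       of_bool (compatible I E f s w) * of_bool (compatible I E f t w) *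
       (\<Prod>e\<in>E. if w e then exp \<beta> - exp (- \<beta>) else exp (- \<beta>)) *
       (1 / 2) ^ card {C \<in> components_of I B E w. C \<inter> B = {}})"
    \<comment> \<open>The indicator of \<open>compatible I E f s w\<close> from
      \<open>edwards_sokal\<close> supplies the premise of \<open>pmf_recolor\<close>; where it
      vanishes, both sides are 0.\<close>
    by (intro sum.cong refl) (simp add: edwards_sokal[OF s \<beta>] pmf_recolor t)
  finally show ?thesis .
qed

section \<open>Detailed balance for each of the two moves\<close>

lemma p_V_P_SW_sym:
  assumes "s \<in> configs I" and "t \<in> configs I" and "\<beta> > 0"
  shows "p_V I B E f \<beta> s * P_SW I B E f \<beta> s t = p_V I B E f \<beta> t * P_SW I B E f \<beta> t s"
proof -
  have "ising_weight I B E f \<beta> s * P_SW I B E f \<beta> s t =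
        ising_weight I B E f \<beta> t * P_SW I B E f \<beta> t s"
    unfolding ising_weight_P_SW[OF assms] ising_weight_P_SW[OF assms(2,1,3)]
    by (simp add: mult_ac)
  then show ?thesis
    by (simp add: p_V_def)
qed

lemma p_V_pos:
  assumes "s \<in> configs I"
  shows "p_V I B E f \<beta> s > 0"
proof -
  have "(\<Sum>r\<in>configs I. ising_weight I B E f \<beta> r) > 0"
    using assms finite_configs ising_weight_pos by (intro sum_pos) auto
  then show ?thesis
    by (simp add: p_V_def ising_weight_pos)
qed

text \<open>For distinct \<open>s\<close> and \<open>t\<close> only acceptance contributes, and the
  probability flow is the minimum of the two probabilities if one state is proposed from the other,
  and 0 otherwise. Both are symmetric, the latter because the proposal is an involution.\<close>

lemma p_V_P_MDF_sym:
  assumes m: "m \<in> I \<rightarrow> I" "\<forall>i\<in>I. m (m i) = i"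
    and s: "s \<in> configs I" and t: "t \<in> configs I"
  shows "p_V I B E f \<beta> s * P_MDF I B E f \<beta> m s t = p_V I B E f \<beta> t * P_MDF I B E f \<beta> m t s"
proof (cases "s = t")
  case False
  \<comment> \<open>Membership in \<open>configs I\<close> settles the points outside
    \<open>I\<close>, where the proposal is \<open>undefined\<close>.\<close>
  have invol: "flip_proposal I m (flip_proposal I m r) = r" if "r \<in> configs I" for r
  proof
    fix i show "flip_proposal I m (flip_proposal I m r) i = r i"
      using m configs_outside[OF that] by (cases "i \<in> I") (auto simp: flip_proposal_def)
  qed
  then have iff: "t = flip_proposal I m s \<longleftrightarrow> s = flip_proposal I m t"
    using s t by metis
  have half: "p_V I B E f \<beta> s * P_MDF I B E f \<beta> m s t =
      min (p_V I B E f \<beta> s) (p_V I B E f \<beta> t) * of_bool (t = flip_proposal I m s)"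
    if "s \<in> configs I" "s \<noteq> t" for s t
    using that p_V_pos[OF that(1), of \<beta>] by (auto simp: P_MDF_def Let_def min_def field_simps)
  show ?thesis
    using half[OF s False] half[OF t False[symmetric]] iff by (simp add: min.commute)
qed simp

end

theorem theorem4:
  fixes \<Omega> bd_plus bd_minus :: "(real ^ 2) set"
    and \<mu> :: "real ^ 2 \<Rightarrow> real ^ 2"
    and I B :: "'v set"
    and E :: "'v set set"
    and x :: "'v \<Rightarrow> real ^ 2"
    and f :: "'v \<Rightarrow> real"
    and \<beta> \<eta> :: real
    and m :: "'v \<Rightarrow> 'v"
  assumes "open \<Omega>" and "connected \<Omega>" and "\<Omega> \<noteq> {}"
    and "frontier \<Omega> = bd_plus \<union> bd_minus"
    and "continuous_on (closure \<Omega>) \<mu>"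
    and "\<mu> \<in> closure \<Omega> \<rightarrow> closure \<Omega>"
    and "\<forall>z\<in>closure \<Omega>. \<mu> (\<mu> z) = z"
    and "\<mu> ` bd_plus = bd_minus"
    and "ising_graph I B E"
    and "inj_on x (I \<union> B)"
    and "\<forall>i\<in>I. x i \<in> interior \<Omega>"
    and "\<forall>b\<in>B. x b \<in> frontier \<Omega>"
    and "\<forall>b\<in>B. (x b \<in> bd_plus \<longrightarrow> f b = 1) \<and> (x b \<in> bd_minus \<longrightarrow> f b = - 1)"
    and "\<beta> > 0"
    and "m \<in> I \<rightarrow> I"
    and "\<forall>i\<in>I. m (m i) = i"
    and "0 < \<eta>" and "\<eta> < 1"
  shows "\<forall>s\<in>configs I. \<forall>t\<in>configs I.
           p_V I B E f \<beta> s * P_SWMDF I B E f \<beta> m \<eta> s t =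
           p_V I B E f \<beta> t * P_SWMDF I B E f \<beta> m \<eta> t s"
proof (intro ballI)
  fix s t assume st: "s \<in> configs I" "t \<in> configs I"
  \<comment> \<open>Each \<open>x b\<close> lies on the frontier, hence in \<open>bd_plus\<close> or
    \<open>bd_minus\<close>, which forces \<open>f b\<close> to be 1 or -1.\<close>
  interpret ising_model I B E f
    using assms(4,9,12,13) by unfold_locales auto
  show "p_V I B E f \<beta> s * P_SWMDF I B E f \<beta> m \<eta> s t =
        p_V I B E f \<beta> t * P_SWMDF I B E f \<beta> m \<eta> t s"
    using p_V_P_MDF_sym[OF assms(15,16) st, of \<beta>] p_V_P_SW_sym[OF st \<open>\<beta> > 0\<close>]
    by (simp add: P_SWMDF_def distrib_left mult.left_commute)
qed

end
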